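(* Let $x_0\in\mathbb{R}$. Suppose that Problem $(P_{x_0})$ is well-defined and finite, and that $U(\cdot,b)$ is nondecreasing, upper semicontinuous and concave for every $b\in E$. (It is not required that $\underline{x}_b>-\infty$, nor that $\mathbb{P}$ be non-atomic.) Then a random variable $X:\Omega\to\mathbb{R}$ is an optimal solution of Problem $(P_{x_0})$ if and only if $$X\in\mathcal{X}_B(\lambda\xi)\ \text{ a.s. for some }\lambda\in[0,+\infty],$$ with $X$ satisfying the budget constraint $\mathbb{E}[\xi X]=x_0$ and $U(X,B)>-\infty$ a.s.
   Context: Setting: $(\Omega,\mathcal{F},\mathbb{P})$ is a probability space, $\xi:\Omega\to(0,+\infty)$ is a random variable, $(E,\mathcal{E})$ is a measurable space, $B:(\Omega,\mathcal{F})\to(E,\mathcal{E})$ is an $E$-valued random variable, and $U:\mathbb{R}\times E\to\mathbb{R}\cup\{-\infty\}$ is such that $U(x,\cdot)$ is measurable on $(E,\mathcal{E})$ for every $x\in\mathbb{R}$. For $b\in E$ let $\underline{x}_b=\inf\{x\in\mathbb{R}:U(x,b)>-\infty\}$. For $x_0\in\mathbb{R}$, Problem $(P_{x_0})$ is: maximize $\mathbb{E}[U(X,B)]$ over all admissible $X$, i.e. all random variables $X:\Omega\to\mathbb{R}$ with $\mathbb{E}[\xi X]\le x_0$ and $U(X,B)>-\infty$ a.s. An optimal solution is an admissible $X$ attaining the supremum. An admissible $X$ is feasible if $\mathbb{E}[U(X,B)]>-\infty$, and the problem is feasible if it admits a feasible $X$. The problem is well-defined if for every admissible $X$, $\mathbb{E}[U(X,B)^+]<+\infty$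 or $\mathbb{E}[U(X,B)^-]<+\infty$ (where $x^+=\max\{x,0\}$, $x^-=-\min\{x,0\}$). It is finite if the supremum of $\mathbb{E}[U(X,B)]$ over admissible $X$ is $<+\infty$. By convention, a problem that is infeasible, or that has no admissible $X$, is still called well-defined and finite. Conjugate set: for $b\in E$ and $0\le y<+\infty$ let $V_b(y)=\sup_{x\in\mathbb{R}}[U(x,b)-yx]\in\mathbb{R}\cup\{+\infty\}$, and let $\mathcal{X}_b(y)\subset\mathbb{R}\cup\{\pm\infty\}$ be the set of maximizers, understood as follows: a real $x$ belongs to $\mathcal{X}_b(y)$ iff $U(x,b)-yx=V_b(y)$; and $+\infty$ (resp. $-\infty$) belongs to $\mathcal{X}_b(y)$ iff there are real numbers $x_n\uparrow+\infty$ (resp. $x_n\downarrow-\infty$) with $U(x_n,b)-yx_n\to V_b(y)$. Also $\mathcal{X}_b(+\infty)=\{\underline{x}_b\}$. For $\lambda\in[0,+\infty]$, $\mathcal{X}_B(\lambda\xi)$ is the random set $\omega\mapsto\mathcal{X}_{B(\omega)}(\lambda\xi(\omega))$, with $\lambda\xi=+\infty$ when $\lambda=+\infty$.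
   Formalization: "Only if" is proved for feasible problems and optimal X with E[ξX]=x0; an optimal X with E[ξX]≠x0 is shown to lie in X_B(λξ) with λ=0. For infeasible problems only "if" is proved. The literal claim fails for U=0, ξ=1, x0=0, X=-1. *)

theory Defs
  imports "HOL-Probability.Probability"
begin

text \<open>
  The expectation of an extended-real function is the difference of the integrals of its positive
  and negative parts. It exists if at least one of the two is finite. When both are infinite, the
  total function below returns minus infinity. Hence in an infeasible problem every admissible
  expected utility is minus infinity, in accordance with the convention that such a problem is
  well-defined and finite.
\<close>

definition pos_part_integral :: "'a measure \<Rightarrow> ('a \<Rightarrow> ereal) \<Rightarrow> ennreal" where
  "pos_part_integral M f = (\<integral>\<^sup>+ \<omega>. e2ennreal (max (f \<omega>) 0) \<partial>M)"

definition neg_part_integral :: "'a measure \<Rightarrow> ('a \<Rightarrow> ereal) \<Rightarrow> ennreal" where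
  "neg_part_integral M f = (\<integral>\<^sup>+ \<omega>. e2ennreal (- min (f \<omega>) 0) \<partial>M)"

definition expectation_exists :: "'a measure \<Rightarrow> ('a \<Rightarrow> ereal) \<Rightarrow> bool" where
  "expectation_exists M f \<longleftrightarrow> pos_part_integral M f < \<infinity> \<or> neg_part_integral M f < \<infinity>"

definition ext_expectation :: "'a measure \<Rightarrow> ('a \<Rightarrow> ereal) \<Rightarrow> ereal" where
  "ext_expectation M f =
     (if neg_part_integral M f = \<infinity> then - \<infinity>
      else enn2ereal (pos_part_integral M f) - enn2ereal (neg_part_integral M f))"

definition cost :: "'a measure \<Rightarrow> ('a \<Rightarrow> real) \<Rightarrow> ('a \<Rightarrow> real) \<Rightarrow> ereal" where
  "cost M \<xi> X = ext_expectation M (\<lambda>\<omega>. ereal (\<xi> \<omega> * X \<omega>))"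

definition expected_utility ::
    "'a measure \<Rightarrow> ('a \<Rightarrow> 'e) \<Rightarrow> (real \<Rightarrow> 'e \<Rightarrow> ereal) \<Rightarrow> ('a \<Rightarrow> real) \<Rightarrow> ereal" where
  "expected_utility M B U X = ext_expectation M (\<lambda>\<omega>. U (X \<omega>) (B \<omega>))"

text \<open>
  The cost of an admissible position has to exist, but it may be minus infinity.
\<close>

definition admissible ::
    "'a measure \<Rightarrow> ('a \<Rightarrow> real) \<Rightarrow> ('a \<Rightarrow> 'e) \<Rightarrow> (real \<Rightarrow> 'e \<Rightarrow> ereal) \<Rightarrow> real \<Rightarrow> ('a \<Rightarrow> real) \<Rightarrow> bool" where
  "admissible M \<xi> B U x0 X \<longleftrightarrow>
     X \<in> borel_measurable M \<and>
     expectation_exists M (\<lambda>\<omega>. ereal (\<xi> \<omega> * X \<omega>)) \<and> cost M \<xi> X \<le> ereal x0 \<and>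
     (AE \<omega> in M. U (X \<omega>) (B \<omega>) > - \<infinity>)"

definition feasible_problem ::
    "'a measure \<Rightarrow> ('a \<Rightarrow> real) \<Rightarrow> ('a \<Rightarrow> 'e) \<Rightarrow> (real \<Rightarrow> 'e \<Rightarrow> ereal) \<Rightarrow> real \<Rightarrow> bool" where
  "feasible_problem M \<xi> B U x0 \<longleftrightarrow>
     (\<exists>X. admissible M \<xi> B U x0 X \<and> expected_utility M B U X > - \<infinity>)"

definition optimal_value ::
    "'a measure \<Rightarrow> ('a \<Rightarrow> real) \<Rightarrow> ('a \<Rightarrow> 'e) \<Rightarrow> (real \<Rightarrow> 'e \<Rightarrow> ereal) \<Rightarrow> real \<Rightarrow> ereal" where
  "optimal_value M \<xi> B U x0 = (SUP X \<in> {X. admissible M \<xi> B U x0 X}. expected_utility M B U X)"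

definition optimal_solution ::
    "'a measure \<Rightarrow> ('a \<Rightarrow> real) \<Rightarrow> ('a \<Rightarrow> 'e) \<Rightarrow> (real \<Rightarrow> 'e \<Rightarrow> ereal) \<Rightarrow> real \<Rightarrow> ('a \<Rightarrow> real) \<Rightarrow> bool" where
  "optimal_solution M \<xi> B U x0 X \<longleftrightarrow>
     admissible M \<xi> B U x0 X \<and> expected_utility M B U X = optimal_value M \<xi> B U x0"

definition well_defined_problem ::
    "'a measure \<Rightarrow> ('a \<Rightarrow> real) \<Rightarrow> ('a \<Rightarrow> 'e) \<Rightarrow> (real \<Rightarrow> 'e \<Rightarrow> ereal) \<Rightarrow> real \<Rightarrow> bool" where
  "well_defined_problem M \<xi> B U x0 \<longleftrightarrow>
     \<not> feasible_problem M \<xi> B U x0 \<or>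
     (\<forall>X. admissible M \<xi> B U x0 X \<longrightarrow> expectation_exists M (\<lambda>\<omega>. U (X \<omega>) (B \<omega>)))"

definition finite_problem ::
    "'a measure \<Rightarrow> ('a \<Rightarrow> real) \<Rightarrow> ('a \<Rightarrow> 'e) \<Rightarrow> (real \<Rightarrow> 'e \<Rightarrow> ereal) \<Rightarrow> real \<Rightarrow> bool" where
  "finite_problem M \<xi> B U x0 \<longleftrightarrow>
     \<not> feasible_problem M \<xi> B U x0 \<or> optimal_value M \<xi> B U x0 < \<infinity>"

text \<open>
  The library notion of concavity is for real-valued functions only. Below no sum of opposite
  infinities occurs, because it is only used for functions that avoid plus infinity.
\<close>

definition ext_concave :: "(real \<Rightarrow> ereal) \<Rightarrow> bool" where
  "ext_concave f \<longleftrightarrow>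
     (\<forall>x y t. 0 < t \<and> t < 1 \<longrightarrow>
        ereal (1 - t) * f x + ereal t * f y \<le> f ((1 - t) * x + t * y))"

definition upper_semicontinuous :: "(real \<Rightarrow> ereal) \<Rightarrow> bool" where
  "upper_semicontinuous f \<longleftrightarrow> (\<forall>x. Limsup (at x) f \<le> f x)"

definition lower_endpoint :: "(real \<Rightarrow> 'e \<Rightarrow> ereal) \<Rightarrow> 'e \<Rightarrow> ereal" where
  "lower_endpoint U b = (INF x \<in> {x. U x b > - \<infinity>}. ereal x)"

definition conjugate :: "(real \<Rightarrow> 'e \<Rightarrow> ereal) \<Rightarrow> 'e \<Rightarrow> real \<Rightarrow> ereal" where
  "conjugate U b y = (SUP x. U x b - ereal (y * x))"

definition conjugate_set :: "(real \<Rightarrow> 'e \<Rightarrow> ereal) \<Rightarrow> 'e \<Rightarrow> ereal \<Rightarrow> ereal set" where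
  "conjugate_set U b y =
     (if y = \<infinity> then {lower_endpoint U b}
      else let r = real_of_ereal y in
        {ereal x |x. U x b - ereal (r * x) = conjugate U b r} \<union>
        {z. z = \<infinity> \<and> (\<exists>x :: nat \<Rightarrow> real. incseq x \<and> filterlim x at_top sequentially \<and>
              (\<lambda>n. U (x n) b - ereal (r * x n)) \<longlonglongrightarrow> conjugate U b r)} \<union>
        {z. z = - \<infinity> \<and> (\<exists>x :: nat \<Rightarrow> real. decseq x \<and> filterlim x at_bot sequentially \<and>
              (\<lambda>n. U (x n) b - ereal (r * x n)) \<longlonglongrightarrow> conjugate U b r)})"

text \<open>
  The first-order condition: the random variable lies almost surely in the conjugate set at
  \<open>l * \<xi>\<close>, which is infinite for infinite \<open>l\<close> since \<open>\<xi>\<close> is positive.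
\<close>

definition in_conjugate_set ::
    "'a measure \<Rightarrow> ('a \<Rightarrow> real) \<Rightarrow> ('a \<Rightarrow> 'e) \<Rightarrow> (real \<Rightarrow> 'e \<Rightarrow> ereal) \<Rightarrow> ereal \<Rightarrow> ('a \<Rightarrow> real) \<Rightarrow> bool" where
  "in_conjugate_set M \<xi> B U l X \<longleftrightarrow>
     (AE \<omega> in M. ereal (X \<omega>) \<in> conjugate_set U (B \<omega>) (l * ereal (\<xi> \<omega>)))"

end

theory Submission
  imports Defs
begin

text \<open>
  Sufficiency of the first-order condition is the Lagrangian argument. If \<open>X\<close> lies in the conjugate
  set at a real multiplier \<open>l\<close>, then \<open>U(Y,B) + l \<xi> (X - Y) \<le> U(X,B)\<close> almost surely for every \<open>Y\<close>,
  and \<open>X\<close> exhausts the budget, so integrating gives optimality. The work is in integrability, because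
  the cost of a competitor \<open>Y\<close> may be minus infinity; \<open>conjugate_set_real_optimal\<close> settles this. At
  an infinite multiplier \<open>X\<close> is the smallest position with finite utility and already uses up the budget,
  hence it is the only admissible one up to null sets (\<open>lower_endpoint_optimal\<close>).

  Necessity is a perturbation argument, in which concavity of the utility replaces divisibility of
  the probability space: on an atom the set on which one trades cannot be made smaller, but the
  size of the trade can. Call \<open>l\<close> an upper rate if buying never yields more than \<open>l\<close> units of
  utility per unit of money, and a lower rate if selling never costs less than \<open>l\<close> units of utility
  per unit of money raised. If \<open>q\<close> is not an upper rate, there is a set of positive probability on
  which every small purchase, paid for in units of money (that is, \<open>s / \<xi>\<close> units of the position),
  yields more than \<open>q s\<close> (\<open>exploitable_set\<close>); likewise for sales. If \<open>p < q\<close> and \<open>q\<close> is not an upper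
  rate and \<open>p\<close> is not a lower rate, then buying on one set and selling on the other, with equal
  total amounts of money, raises expected utility at no cost (\<open>optimal_rates_ordered\<close>). So at an
  optimum the two families of rates leave no gap. Both are closed, so the infimum of the upper rates
  is at once an upper and a lower rate, which is membership in the conjugate set; if there are no
  upper rates at all, every number is a lower rate, so nothing can be sold and \<open>X\<close> is the lower
  endpoint. When the budget is slack, purchases alone are affordable, so every positive number is an
  upper rate and the multiplier is zero.
\<close>

section \<open>The extended expectation\<close>

lemma ext_expectation_mono:
  assumes "AE w in M. f w \<le> g w"
  shows "ext_expectation M f \<le> ext_expectation M g"
proof -
  have p: "pos_part_integral M f \<le> pos_part_integral M g"
    unfolding pos_part_integral_def
  proof (rule nn_integral_mono_AE)
    show "AE w in M. e2ennreal (max (f w) 0) \<le> e2ennreal (max (g w) 0)"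
      using assms by eventually_elim (intro e2ennreal_mono max.mono, auto)
  qed
  have n: "neg_part_integral M g \<le> neg_part_integral M f"
    unfolding neg_part_integral_def
  proof (rule nn_integral_mono_AE)
    show "AE w in M. e2ennreal (- min (g w) 0) \<le> e2ennreal (- min (f w) 0)"
      using assms
    proof eventually_elim
      case (elim w)
      then have "min (f w) 0 \<le> min (g w) 0" by (intro min.mono) auto
      then show ?case by (intro e2ennreal_mono) auto
    qed
  qed
  show ?thesis
  proof (cases "neg_part_integral M f = \<infinity>")
    case True
    then show ?thesis by (simp add: ext_expectation_def)
  next
    case False
    with n have "neg_part_integral M g \<noteq> \<infinity>" by (auto simp: top_unique)
    with False p n show ?thesis
      by (auto simp: ext_expectation_def less_eq_ennreal.rep_eq intro!: ereal_minus_mono)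
  qed
qed

lemma ext_expectation_cong:
  assumes "AE w in M. f w = g w"
  shows "ext_expectation M f = ext_expectation M g"
  using assms by (intro antisym ext_expectation_mono) auto

lemma pos_part_integral_real: "pos_part_integral M (\<lambda>w. ereal (g w)) = (\<integral>\<^sup>+ w. ennreal (g w) \<partial>M)"
proof -
  have "e2ennreal (max (ereal x) 0) = ennreal x" for x
    by (cases "x \<ge> 0") (auto simp: max_def ennreal_neg zero_ereal_def)
  then show ?thesis by (simp add: pos_part_integral_def)
qed

lemma neg_part_integral_real: "neg_part_integral M (\<lambda>w. ereal (g w)) = (\<integral>\<^sup>+ w. ennreal (- g w) \<partial>M)"
proof -
  have "e2ennreal (- min (ereal x) 0) = ennreal (- x)" for x
    by (cases "x \<ge> 0") (auto simp: min_def ennreal_neg zero_ereal_def)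
  then show ?thesis by (simp add: neg_part_integral_def)
qed

lemma ext_expectation_integrable:
  assumes "integrable M g"
  shows "ext_expectation M (\<lambda>w. ereal (g w)) = ereal (\<integral>w. g w \<partial>M)"
proof -
  obtain r s where *: "r \<ge> 0" "s \<ge> 0" "(\<integral>\<^sup>+ w. ennreal (g w) \<partial>M) = ennreal r"
      "(\<integral>\<^sup>+ w. ennreal (- g w) \<partial>M) = ennreal s" "(\<integral>w. g w \<partial>M) = r - s"
    by (rule integrableE[OF assms])
  then show ?thesis
    by (simp add: ext_expectation_def pos_part_integral_real neg_part_integral_real enn2ereal_ennreal)
qed

text \<open>
  Passes from extended to Bochner integrals: a finite value forces both parts to be finite, since
  an infinite negative part is sent to minus infinity by definition.
\<close>

lemma ext_expectation_finiteD:
  fixes f :: "'a \<Rightarrow> ereal"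
  assumes f: "f \<in> borel_measurable M" and "ext_expectation M f \<noteq> \<infinity>" "ext_expectation M f \<noteq> - \<infinity>"
  shows "integrable M (\<lambda>w. real_of_ereal (f w))"
    and "AE w in M. f w = ereal (real_of_ereal (f w))"
    and "ext_expectation M f = ereal (\<integral>w. real_of_ereal (f w) \<partial>M)"
proof -
  have n: "neg_part_integral M f \<noteq> \<infinity>"
    using assms by (auto simp: ext_expectation_def)
  have p: "pos_part_integral M f \<noteq> \<infinity>"
    using assms n
    by (cases "neg_part_integral M f") (auto simp: ext_expectation_def split: if_splits)
  have "AE w in M. e2ennreal (max (f w) 0) \<noteq> \<infinity>"
    using p unfolding pos_part_integral_def by (intro nn_integral_noteq_infinite) (use f in auto)
  moreover have "AE w in M. e2ennreal (- min (f w) 0) \<noteq> \<infinity>"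
    using n unfolding neg_part_integral_def by (intro nn_integral_noteq_infinite) (use f in auto)
  ultimately show AE: "AE w in M. f w = ereal (real_of_ereal (f w))"
  proof eventually_elim
    case (elim w)
    then show ?case by (cases "f w") auto
  qed
  have "ennreal (real_of_ereal x) \<le> e2ennreal (max x 0)" for x :: ereal
    by (cases x; cases "real_of_ereal x \<ge> 0") (auto simp: max_def ennreal_neg zero_ereal_def)
  then have "(\<integral>\<^sup>+ w. ennreal (real_of_ereal (f w)) \<partial>M) \<le> pos_part_integral M f"
    unfolding pos_part_integral_def by (intro nn_integral_mono)
  moreover have "ennreal (- real_of_ereal x) \<le> e2ennreal (- min x 0)" for x :: ereal
    by (cases x; cases "real_of_ereal x \<ge> 0") (auto simp: min_def ennreal_neg zero_ereal_def)
  then have "(\<integral>\<^sup>+ w. ennreal (- real_of_ereal (f w)) \<partial>M) \<le> neg_part_integral M f"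
    unfolding neg_part_integral_def by (intro nn_integral_mono)
  ultimately show int: "integrable M (\<lambda>w. real_of_ereal (f w))"
    unfolding real_integrable_def using f n p by (auto simp: top_unique)
  show "ext_expectation M f = ereal (\<integral>w. real_of_ereal (f w) \<partial>M)"
    using ext_expectation_cong[OF AE] ext_expectation_integrable[OF int] by simp
qed

lemma pos_part_integral_finite:
  assumes "expectation_exists M f" "ext_expectation M f \<noteq> \<infinity>"
  shows "pos_part_integral M f \<noteq> \<infinity>"
  using assms
  by (cases "neg_part_integral M f")
     (auto simp: expectation_exists_def ext_expectation_def split: if_splits)

lemma integrable_max_0:
  assumes g: "g \<in> borel_measurable M" and "pos_part_integral M (\<lambda>w. ereal (g w)) \<noteq> \<infinity>"
  shows "integrable M (\<lambda>w. max (g w) 0 :: real)"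
proof -
  have "ennreal (max x 0) = ennreal x" "ennreal (- max x 0) = 0" for x
    by (auto simp: max_def ennreal_neg)
  then show ?thesis
    using assms unfolding real_integrable_def by (simp add: pos_part_integral_real)
qed

text \<open>
  This holds even when the expectation of \<open>g\<close> is minus infinity. It allows positions whose cost is
  minus infinity to be perturbed.
\<close>

lemma ext_expectation_add_integrable:
  assumes g: "g \<in> borel_measurable M" and k: "integrable M k"
    and p: "pos_part_integral M (\<lambda>w. ereal (g w)) \<noteq> \<infinity>"
  shows "pos_part_integral M (\<lambda>w. ereal (g w + k w)) \<noteq> \<infinity>"
    and "ext_expectation M (\<lambda>w. ereal (g w + k w)) =
         ext_expectation M (\<lambda>w. ereal (g w)) + ereal (\<integral>w. k w \<partial>M)"
proof -
  have km[measurable]: "k \<in> borel_measurable M" and gm[measurable]: "g \<in> borel_measurable M"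
    using g k by auto
  have kfin: "(\<integral>\<^sup>+ w. ennreal \<bar>k w\<bar> \<partial>M) < \<infinity>"
    using k unfolding integrable_iff_bounded by simp
  have "(\<integral>\<^sup>+ w. ennreal (g w + k w) \<partial>M) \<le> (\<integral>\<^sup>+ w. ennreal (g w) + ennreal \<bar>k w\<bar> \<partial>M)"
  proof (rule nn_integral_mono)
    fix w
    have "ennreal (g w + k w) \<le> ennreal (max (g w) 0 + \<bar>k w\<bar>)" by (intro ennreal_leI) auto
    also have "\<dots> = ennreal (g w) + ennreal \<bar>k w\<bar>"
      by (auto simp: max_def ennreal_neg)
    finally show "ennreal (g w + k w) \<le> ennreal (g w) + ennreal \<bar>k w\<bar>" .
  qed
  also have "\<dots> = (\<integral>\<^sup>+ w. ennreal (g w) \<partial>M) + (\<integral>\<^sup>+ w. ennreal \<bar>k w\<bar> \<partial>M)"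
    by (intro nn_integral_add) auto
  also have "\<dots> < \<infinity>"
    using kfin p by (simp add: pos_part_integral_real less_top)
  finally show pos: "pos_part_integral M (\<lambda>w. ereal (g w + k w)) \<noteq> \<infinity>"
    by (simp add: pos_part_integral_real)
  show "ext_expectation M (\<lambda>w. ereal (g w + k w)) =
         ext_expectation M (\<lambda>w. ereal (g w)) + ereal (\<integral>w. k w \<partial>M)"
  proof (cases "neg_part_integral M (\<lambda>w. ereal (g w)) = \<infinity>")
    case False
    with p have "integrable M g"
      unfolding real_integrable_def by (simp add: pos_part_integral_real neg_part_integral_real)
    then show ?thesis using k by (simp add: ext_expectation_integrable)
  next
    case True
    have "neg_part_integral M (\<lambda>w. ereal (g w)) \<le>
        (\<integral>\<^sup>+ w. ennreal (- (g w + k w)) + ennreal \<bar>k w\<bar> \<partial>M)"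
      unfolding neg_part_integral_real
    proof (rule nn_integral_mono)
      fix w
      have "ennreal (- g w) \<le> ennreal (max (- (g w + k w)) 0 + \<bar>k w\<bar>)" by (intro ennreal_leI) auto
      also have "\<dots> = ennreal (- (g w + k w)) + ennreal \<bar>k w\<bar>"
        by (auto simp: max_def ennreal_neg)
      finally show "ennreal (- g w) \<le> ennreal (- (g w + k w)) + ennreal \<bar>k w\<bar>" .
    qed
    also have "\<dots> = neg_part_integral M (\<lambda>w. ereal (g w + k w)) + (\<integral>\<^sup>+ w. ennreal \<bar>k w\<bar> \<partial>M)"
      unfolding neg_part_integral_real by (intro nn_integral_add) auto
    finally have "neg_part_integral M (\<lambda>w. ereal (g w + k w)) = \<infinity>"
      using True kfin by (auto simp: top_unique)
    with True show ?thesis by (simp add: ext_expectation_def)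
  qed
qed

section \<open>Concave functions and conjugate sets\<close>

text \<open>
  A gain obtained by a long step is obtained, in proportion, by every shorter step: chords of a
  concave function get flatter away from \<open>x\<close>. Strictness is kept because \<open>f x\<close> is finite.
\<close>

lemma ext_concave_gain:
  assumes "ext_concave f" and "\<And>z. f z \<noteq> \<infinity>" and "- \<infinity> < f x"
    and gain: "f x + ereal c < f (x + k)" and t: "0 < t" "t \<le> 1"
  shows "f x + ereal (t * c) < f (x + t * k)"
proof (cases "t = 1")
  case True
  with gain show ?thesis by simp
next
  case False
  with t have t1: "t < 1" by simp
  obtain u where u: "f x = ereal u" using assms by (cases "f x") auto
  obtain v where v: "f (x + k) = ereal v" using assms(2)[of "x + k"] gain u by (cases "f (x + k)") auto
  have "u + c < v" using gain u v by simp
  then have "t * (u + c) < t * v" using t by simp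
  then have "u + t * c < (1 - t) * u + t * v" by (simp add: algebra_simps)
  then have "f x + ereal (t * c) < ereal (1 - t) * f x + ereal t * f (x + k)"
    by (simp add: u v)
  also have "\<dots> \<le> f ((1 - t) * x + t * (x + k))"
    using \<open>ext_concave f\<close> t t1 unfolding ext_concave_def by blast
  also have "(1 - t) * x + t * (x + k) = x + t * k" by (simp add: algebra_simps)
  finally show ?thesis .
qed

text \<open>
  A monotone upper semicontinuous function is right-continuous, so countably many of its values
  determine it. This gives measurability of \<open>U(X,B)\<close> from measurability of each \<open>U(x,B)\<close>.
\<close>

lemma mono_usc_eq_INF_rat:
  fixes f :: "real \<Rightarrow> ereal"
  assumes "mono f" "upper_semicontinuous f"
  shows "f x = (INF q. if x < real_of_rat q then f (real_of_rat q) else \<infinity>)" (is "_ = ?I")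
proof (rule antisym)
  show "f x \<le> ?I"
    by (rule INF_greatest) (auto intro: monoD[OF \<open>mono f\<close>])
  have lb: "?I \<le> f y" if "x < y" for y
  proof -
    obtain q where q: "x < real_of_rat q" "real_of_rat q < y" using of_rat_dense[OF \<open>x < y\<close>] by blast
    have "?I \<le> (if x < real_of_rat q then f (real_of_rat q) else \<infinity>)" by (rule INF_lower) simp
    also have "\<dots> \<le> f y" using q monoD[OF \<open>mono f\<close>, of "real_of_rat q" y] by simp
    finally show ?thesis .
  qed
  have "?I \<le> Limsup (at x) f"
  proof (rule ccontr)
    assume "\<not> ?thesis"
    then have "\<forall>\<^sub>F y in at x. f y < ?I" by (intro Limsup_lessD) simp
    then have "\<forall>\<^sub>F y in at_right x. f y < ?I"
      by (simp add: eventually_at_split)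
    moreover have "\<forall>\<^sub>F y in at_right x. x < y" by (simp add: eventually_at_filter)
    ultimately have "\<forall>\<^sub>F y in at_right x. False"
      by eventually_elim (use lb in \<open>auto simp: not_less[symmetric]\<close>)
    then show False by (simp add: trivial_limit_at_right_real)
  qed
  also have "\<dots> \<le> f x" using assms(2) by (simp add: upper_semicontinuous_def)
  finally show "?I \<le> f x" .
qed

lemma real_in_conjugate_set_iff:
  "ereal x \<in> conjugate_set U b (ereal r) \<longleftrightarrow>
    (\<forall>z. U z b - ereal (r * z) \<le> U x b - ereal (r * x))"
proof -
  have "ereal x \<in> conjugate_set U b (ereal r) \<longleftrightarrow> U x b - ereal (r * x) = conjugate U b r"
    by (simp add: conjugate_set_def)
  also have "\<dots> \<longleftrightarrow> (\<forall>z. U z b - ereal (r * z) \<le> U x b - ereal (r * x))"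
    unfolding conjugate_def
    by (metis (no_types, lifting) SUP_upper SUP_least UNIV_I antisym)
  finally show ?thesis .
qed

lemma in_conjugate_set_if_rates:
  fixes U :: "real \<Rightarrow> 'e \<Rightarrow> ereal"
  assumes u: "U x b = ereal u" and fin: "\<And>z. U z b \<noteq> \<infinity>"
    and up: "\<And>h. 0 < h \<Longrightarrow> U (x + h) b \<le> U x b + ereal (r * h)"
    and down: "\<And>h. 0 < h \<Longrightarrow> U (x - h) b \<le> U x b - ereal (r * h)"
  shows "ereal x \<in> conjugate_set U b (ereal r)"
  unfolding real_in_conjugate_set_iff
proof
  fix z
  have "U z b \<le> U x b + ereal (r * (z - x))"
    using up[of "z - x"] down[of "x - z"] u
    by (cases z x rule: linorder_cases) (auto simp: algebra_simps)
  then show "U z b - ereal (r * z) \<le> U x b - ereal (r * x)"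
    using u by (cases "U z b") (auto simp: algebra_simps)
qed

section \<open>Perturbations of a position\<close>

locale utility_problem = prob_space M for M :: "'a measure" +
  fixes E :: "'e measure" and \<xi> :: "'a \<Rightarrow> real" and B :: "'a \<Rightarrow> 'e"
    and U :: "real \<Rightarrow> 'e \<Rightarrow> ereal" and x0 :: real
  assumes \<xi>_measurable[measurable]: "\<xi> \<in> borel_measurable M"
    and \<xi>_pos: "\<And>w. w \<in> space M \<Longrightarrow> 0 < \<xi> w"
    and B_measurable[measurable]: "B \<in> measurable M E"
    and U_measurable[measurable]: "\<And>x. U x \<in> borel_measurable E"
    and U_not_infty: "\<And>x b. b \<in> space E \<Longrightarrow> U x b \<noteq> \<infinity>"
    and finite_problem: "finite_problem M \<xi> B U x0"
    and U_mono: "\<And>b. b \<in> space E \<Longrightarrow> mono (\<lambda>x. U x b)"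
    and U_usc: "\<And>b. b \<in> space E \<Longrightarrow> upper_semicontinuous (\<lambda>x. U x b)"
    and U_concave: "\<And>b. b \<in> space E \<Longrightarrow> ext_concave (\<lambda>x. U x b)"
begin

lemma B_space: "w \<in> space M \<Longrightarrow> B w \<in> space E"
  using B_measurable by (rule measurable_space)

text \<open>
  The random first argument is approximated from the right by rational constants, which reduces the
  claim to measurability of \<open>U\<close> in its second argument.
\<close>

lemma measurable_utility[measurable]:
  assumes [measurable]: "X \<in> borel_measurable M"
  shows "(\<lambda>w. U (X w) (B w)) \<in> borel_measurable M"
proof -
  have "(\<lambda>w. INF q. if X w < real_of_rat q then U (real_of_rat q) (B w) else \<infinity>) \<in> borel_measurable M"
    by measurable
  also have "?this \<longleftrightarrow> ?thesis"
  proof (rule measurable_cong)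
    fix w assume "w \<in> space M"
    then show "(INF q. if X w < real_of_rat q then U (real_of_rat q) (B w) else \<infinity>) = U (X w) (B w)"
      using mono_usc_eq_INF_rat[OF U_mono U_usc, OF B_space B_space] by simp
  qed
  finally show ?thesis .
qed

lemma admissibleD:
  assumes "admissible M \<xi> B U x0 X"
  shows "X \<in> borel_measurable M" "AE w in M. - \<infinity> < U (X w) (B w)" "cost M \<xi> X \<le> ereal x0"
    "pos_part_integral M (\<lambda>w. ereal (\<xi> w * X w)) \<noteq> \<infinity>"
proof -
  show "X \<in> borel_measurable M" "AE w in M. - \<infinity> < U (X w) (B w)" "cost M \<xi> X \<le> ereal x0"
    using assms by (auto simp: admissible_def)
  then show "pos_part_integral M (\<lambda>w. ereal (\<xi> w * X w)) \<noteq> \<infinity>"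
    using assms by (intro pos_part_integral_finite) (auto simp: admissible_def cost_def)
qed

lemma admissible_of_cost_eq:
  assumes "X \<in> borel_measurable M" "cost M \<xi> X = ereal x0" "AE w in M. - \<infinity> < U (X w) (B w)"
  shows "admissible M \<xi> B U x0 X"
proof -
  have "neg_part_integral M (\<lambda>w. ereal (\<xi> w * X w)) < \<infinity>"
    using assms(2) by (auto simp: cost_def ext_expectation_def less_top split: if_splits)
  with assms show ?thesis by (simp add: admissible_def expectation_exists_def)
qed

lemma cost_eqD:
  assumes [measurable]: "X \<in> borel_measurable M" and "cost M \<xi> X = ereal c"
  shows "integrable M (\<lambda>w. \<xi> w * X w)" "(\<integral>w. \<xi> w * X w \<partial>M) = c"
  using ext_expectation_finiteD[of "\<lambda>w. ereal (\<xi> w * X w)" M] assms(2) by (auto simp: cost_def)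

lemma admissible_utility_not_infty:
  assumes "feasible_problem M \<xi> B U x0" "admissible M \<xi> B U x0 X"
  shows "expected_utility M B U X \<noteq> \<infinity>"
proof -
  have "expected_utility M B U X \<le> optimal_value M \<xi> B U x0"
    unfolding optimal_value_def using assms by (intro SUP_upper) auto
  also have "\<dots> < \<infinity>" using finite_problem assms by (auto simp: finite_problem_def)
  finally show ?thesis by simp
qed

lemma optimal_upper:
  assumes "optimal_solution M \<xi> B U x0 X" "admissible M \<xi> B U x0 Y"
  shows "expected_utility M B U Y \<le> expected_utility M B U X"
  using assms unfolding optimal_solution_def optimal_value_def by (auto intro: SUP_upper)

lemma optimal_solutionI:
  assumes "admissible M \<xi> B U x0 X"
    and "\<And>Y. admissible M \<xi> B U x0 Y \<Longrightarrow> expected_utility M B U Y \<le> expected_utility M B U X"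
  shows "optimal_solution M \<xi> B U x0 X"
  using assms unfolding optimal_solution_def optimal_value_def
  by (auto intro!: antisym SUP_upper SUP_least)

text \<open>
  All perturbations of an optimal position enter through this lemma. An integrable lower bound \<open>g\<close>
  for the gain is enough: the optimal utility is integrable, so it bounds the perturbed expected
  utility from below, whatever the perturbed utility is exactly.
\<close>

lemma optimal_no_improvement:
  assumes feas: "feasible_problem M \<xi> B U x0" and opt: "optimal_solution M \<xi> B U x0 X"
    and D[measurable]: "D \<in> borel_measurable M"
    and int_D: "integrable M (\<lambda>w. \<xi> w * D w)" and int_g: "integrable M g"
    and gain: "AE w in M. U (X w) (B w) + ereal (g w) \<le> U (X w + D w) (B w)"
    and budget: "cost M \<xi> X + ereal (\<integral>w. \<xi> w * D w \<partial>M) \<le> ereal x0"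
  shows "(\<integral>w. g w \<partial>M) \<le> 0"
proof -
  have adm: "admissible M \<xi> B U x0 X" using opt by (simp add: optimal_solution_def)
  note X[measurable] = admissibleD(1)[OF adm]
  let ?Y = "\<lambda>w. X w + D w"
  let ?u = "\<lambda>w. real_of_ereal (U (X w) (B w))"
  have "expected_utility M B U X \<noteq> - \<infinity>"
    using feas optimal_upper[OF opt] unfolding feasible_problem_def by fastforce
  moreover have "expected_utility M B U X \<noteq> \<infinity>"
    by (rule admissible_utility_not_infty[OF feas adm])
  ultimately have u: "integrable M ?u" "AE w in M. U (X w) (B w) = ereal (?u w)"
      "expected_utility M B U X = ereal (\<integral>w. ?u w \<partial>M)"
    using ext_expectation_finiteD[OF measurable_utility[OF X]] unfolding expected_utility_def by blast+
  have gain': "AE w in M. ereal (?u w + g w) \<le> U (?Y w) (B w)"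
    using gain u(2) by eventually_elim (metis plus_ereal.simps(1))
  have Y_cost: "(\<lambda>w. ereal (\<xi> w * ?Y w)) = (\<lambda>w. ereal (\<xi> w * X w + \<xi> w * D w))"
    by (simp add: algebra_simps)
  have "admissible M \<xi> B U x0 ?Y"
    unfolding admissible_def
  proof (intro conjI)
    show "expectation_exists M (\<lambda>w. ereal (\<xi> w * ?Y w))"
      unfolding Y_cost expectation_exists_def
      using ext_expectation_add_integrable(1)[OF _ int_D admissibleD(4)[OF adm]] by (simp add: less_top)
    show "cost M \<xi> ?Y \<le> ereal x0"
      using ext_expectation_add_integrable(2)[OF _ int_D admissibleD(4)[OF adm]] budget
      unfolding cost_def Y_cost by simp
    show "AE w in M. - \<infinity> < U (?Y w) (B w)"
      using gain' by eventually_elim (auto intro: less_le_trans[rotated])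
  qed auto
  then have "expected_utility M B U ?Y \<le> expected_utility M B U X"
    by (rule optimal_upper[OF opt])
  moreover have "ereal (\<integral>w. ?u w + g w \<partial>M) \<le> expected_utility M B U ?Y"
    unfolding expected_utility_def
    using ext_expectation_mono[OF gain'] u(1) int_g by (simp add: ext_expectation_integrable)
  ultimately show ?thesis using u int_g by (simp add: u(3)) (metis dual_order.trans ereal_less_eq(3) add_le_same_cancel1)
qed

text \<open>
  The direction \<open>d\<close> is 1 for purchases, making \<open>l\<close> an upper rate, and \<open>-1\<close> for sales, making it a
  lower rate. In terms of one-sided derivatives of \<open>U(\<cdot>,B)\<close> at \<open>X\<close>, the former says that the right
  derivative is at most \<open>l \<xi>\<close> and the latter that the left derivative is at least \<open>l \<xi>\<close>; the
  finite-difference form stays meaningful where the utility jumps to minus infinity.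
\<close>

definition rate_bound :: "real \<Rightarrow> ('a \<Rightarrow> real) \<Rightarrow> real \<Rightarrow> bool" where
  "rate_bound d X l \<longleftrightarrow>
     (AE w in M. \<forall>h>0. U (X w + d * h) (B w) \<le> U (X w) (B w) + ereal (d * l * \<xi> w * h))"

lemma rate_bound_down_0: "rate_bound (-1) X 0"
  unfolding rate_bound_def using AE_space
proof eventually_elim
  case (elim w)
  then show ?case using monoD[OF U_mono[OF B_space[OF elim]]] by simp
qed

lemma rate_bound_LIMSEQ:
  assumes fin: "AE w in M. - \<infinity> < U (X w) (B w)"
    and "\<And>n::nat. rate_bound d X (q n)" and q: "q \<longlonglongrightarrow> l"
  shows "rate_bound d X l"
proof -
  have "AE w in M. \<forall>n. \<forall>h>0. U (X w + d * h) (B w) \<le> U (X w) (B w) + ereal (d * q n * \<xi> w * h)"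
    using assms(2) unfolding rate_bound_def AE_all_countable by blast
  then show ?thesis
    unfolding rate_bound_def using fin AE_space
  proof eventually_elim
    case (elim w)
    obtain u where u: "U (X w) (B w) = ereal u"
      using elim U_not_infty[OF B_space] by (cases "U (X w) (B w)") auto
    show ?case
    proof (intro allI impI)
      fix h :: real assume "h > 0"
      have "(\<lambda>n. ereal (u + d * q n * \<xi> w * h)) \<longlonglongrightarrow> ereal (u + d * l * \<xi> w * h)"
        by (intro tendsto_intros q)
      moreover have "U (X w + d * h) (B w) \<le> ereal (u + d * q n * \<xi> w * h)" for n
        using elim(1) \<open>h > 0\<close> u by simp
      ultimately show "U (X w + d * h) (B w) \<le> U (X w) (B w) + ereal (d * l * \<xi> w * h)"
        unfolding u plus_ereal.simps(1) by (intro LIMSEQ_le_const[where X = "\<lambda>n. ereal (u + d * q n * \<xi> w * h)"]) blast+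
    qed
  qed
qed

text \<open>
  By concavity a failure of the rate bound for some step size is a failure for all smaller ones, so
  countably many step sizes \<open>1/(n+1)\<close> detect it, and one of them works on a set of positive
  probability. Requiring also \<open>\<xi> \<ge> 1/(n+1)\<close> there makes the steps \<open>s / \<xi>\<close> uniformly small.
\<close>

lemma exploitable_set:
  assumes X[measurable]: "X \<in> borel_measurable M" and fin: "AE w in M. - \<infinity> < U (X w) (B w)"
    and "\<not> rate_bound d X q"
  obtains A s0 where "A \<in> sets M" "0 < measure M A" "0 < s0"
    "\<And>w s. w \<in> A \<Longrightarrow> 0 < s \<Longrightarrow> s \<le> s0 \<Longrightarrow>
       U (X w) (B w) + ereal (d * q * s) < U (X w + d * (s / \<xi> w)) (B w)"
proof -
  define e where "e n = 1 / real (Suc n)" for n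
  have e_pos: "0 < e n" for n by (simp add: e_def)
  define A where "A n = {w \<in> space M. - \<infinity> < U (X w) (B w) \<and> e n \<le> \<xi> w \<and>
      U (X w) (B w) + ereal (d * q * \<xi> w * e n) < U (X w + d * e n) (B w)}" for n
  have A[measurable]: "A n \<in> sets M" for n unfolding A_def by measurable
  have "\<exists>n. measure M (A n) \<noteq> 0"
  proof (rule ccontr)
    assume "\<not> ?thesis"
    then have "A n \<in> null_sets M" for n by (simp add: null_sets_def emeasure_eq_measure)
    then have "AE w in M. \<forall>n. w \<notin> A n" by (simp add: AE_all_countable AE_not_in)
    then have "rate_bound d X q"
      unfolding rate_bound_def using fin AE_space
    proof eventually_elim
      case (elim w)
      show ?case
      proof (rule ccontr)
        assume "\<not> ?thesis"
        then obtain h where h: "h > 0"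
          "U (X w) (B w) + ereal (d * q * \<xi> w * h) < U (X w + d * h) (B w)" by (auto simp: not_le)
        obtain n where n: "e n < min h (\<xi> w)"
          using nat_approx_posE[of "min h (\<xi> w)"] h \<xi>_pos[OF elim(3)] unfolding e_def by auto
        have "U (X w) (B w) + ereal ((e n / h) * (d * q * \<xi> w * h)) < U (X w + (e n / h) * (d * h)) (B w)"
          using elim h n e_pos[of n]
          by (intro ext_concave_gain[where f = "\<lambda>x. U x (B w)"] U_concave U_not_infty B_space) auto
        then have "w \<in> A n" using elim h n by (simp add: A_def mult_ac)
        with elim show False by blast
      qed
    qed
    with \<open>\<not> rate_bound d X q\<close> show False by simp
  qed
  then obtain n where n: "0 < measure M (A n)" by (auto simp: zero_less_measure_iff)
  show thesis
  proof (rule that[OF A n])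
    show "0 < e n * e n" using e_pos[of n] by simp
    fix w s assume w: "w \<in> A n" and s: "0 < s" "s \<le> e n * e n"
    then have w': "w \<in> space M" "- \<infinity> < U (X w) (B w)" "e n \<le> \<xi> w"
      "U (X w) (B w) + ereal (d * q * \<xi> w * e n) < U (X w + d * e n) (B w)" by (auto simp: A_def)
    note \<xi> = \<xi>_pos[OF w'(1)]
    \<comment> \<open>The step \<open>s / \<xi>\<close> as a fraction of the step \<open>e n\<close> in the definition of the set.\<close>
    define t where "t = s / (\<xi> w * e n)"
    have "s \<le> \<xi> w * e n" using s w'(3) e_pos[of n] by (meson mult_right_mono less_imp_le order_trans)
    then have t: "0 < t" "t \<le> 1" using s \<xi> e_pos[of n] by (auto simp: t_def)
    have "U (X w) (B w) + ereal (t * (d * q * \<xi> w * e n)) < U (X w + t * (d * e n)) (B w)"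
      using w' t
      by (intro ext_concave_gain[where f = "\<lambda>x. U x (B w)"] U_concave U_not_infty B_space)
    moreover have "t * (d * q * \<xi> w * e n) = d * q * s" "t * (d * e n) = d * (s / \<xi> w)"
      using \<xi> e_pos[of n] by (auto simp: t_def)
    ultimately show "U (X w) (B w) + ereal (d * q * s) < U (X w + d * (s / \<xi> w)) (B w)" by simp
  qed
qed

section \<open>Necessity of the first-order condition\<close>

text \<open>
  Part of the unspent money would otherwise be spent on an exploitable set.
\<close>

lemma optimal_slack_budget:
  assumes feas: "feasible_problem M \<xi> B U x0" and opt: "optimal_solution M \<xi> B U x0 X"
    and slack: "cost M \<xi> X < ereal x0" and q: "0 < q"
  shows "rate_bound 1 X q"
proof (rule ccontr)
  assume "\<not> ?thesis"
  have adm: "admissible M \<xi> B U x0 X" using opt by (simp add: optimal_solution_def)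
  note X[measurable] = admissibleD(1)[OF adm]
  obtain A s0 where A[measurable]: "A \<in> sets M" and pos: "0 < measure M A" "0 < s0"
    and gain: "\<And>w s. w \<in> A \<Longrightarrow> 0 < s \<Longrightarrow> s \<le> s0 \<Longrightarrow>
       U (X w) (B w) + ereal (1 * q * s) < U (X w + 1 * (s / \<xi> w)) (B w)"
    using exploitable_set[OF X admissibleD(2)[OF adm] \<open>\<not> rate_bound 1 X q\<close>] by blast
  obtain e where e: "0 < e" "cost M \<xi> X + ereal e \<le> ereal x0"
  proof (cases "cost M \<xi> X")
    case (real c)
    then show thesis using slack that[of "x0 - c"] by simp
  qed (use slack that[of 1] in auto)
  define s where "s = min s0 e"
  have s: "0 < s" "s \<le> s0" "s \<le> e" using pos e by (auto simp: s_def)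
  let ?D = "\<lambda>w. s * indicator A w / \<xi> w"
  have D: "\<xi> w * ?D w = s * indicator A w" if "w \<in> space M" for w
    using \<xi>_pos[OF that] by simp
  have int_A: "integrable M (\<lambda>w. c * indicator A w :: real)" for c :: real
    by (intro integrable_mult_right integrable_real_indicator) (auto simp: less_top[symmetric])
  have int_D: "integrable M (\<lambda>w. \<xi> w * ?D w)"
    using int_A[of s] by (subst Bochner_Integration.integrable_cong[OF refl D]) auto
  have "(\<integral>w. \<xi> w * ?D w \<partial>M) = s * measure M A"
    by (subst Bochner_Integration.integral_cong[OF refl D]) auto
  also have "\<dots> \<le> e * 1"
    using s by (intro mult_mono) auto
  finally have "cost M \<xi> X + ereal (\<integral>w. \<xi> w * ?D w \<partial>M) \<le> cost M \<xi> X + ereal e"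
    by (intro add_left_mono) simp
  also note e(2)
  finally have budget: "cost M \<xi> X + ereal (\<integral>w. \<xi> w * ?D w \<partial>M) \<le> ereal x0" .
  have "(\<integral>w. q * s * indicator A w \<partial>M) \<le> 0"
  proof (rule optimal_no_improvement[OF feas opt _ int_D int_A _ budget])
    show "AE w in M. U (X w) (B w) + ereal (q * s * indicator A w) \<le> U (X w + ?D w) (B w)"
    proof (rule AE_I2)
      fix w assume "w \<in> space M"
      show "U (X w) (B w) + ereal (q * s * indicator A w) \<le> U (X w + ?D w) (B w)"
        using gain[OF _ s(1,2), of w] by (cases "w \<in> A") auto
    qed
  qed measurable
  moreover have "0 < q * s * measure M A" using q s pos by simp
  ultimately show False by simp
qed

text \<open>
  Otherwise buy on an exploitable set \<open>A\<close> and sell on an exploitable set \<open>C\<close>. With money amounts per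
  state proportional to the probability of the other set, the trade costs nothing, and it gains
  more than \<open>q\<close> and loses less than \<open>p\<close> per unit of money.
\<close>

lemma optimal_rates_ordered:
  assumes feas: "feasible_problem M \<xi> B U x0" and opt: "optimal_solution M \<xi> B U x0 X"
    and pq: "p < q"
  shows "rate_bound 1 X q \<or> rate_bound (-1) X p"
proof (rule ccontr)
  assume neg: "\<not> ?thesis"
  have adm: "admissible M \<xi> B U x0 X" using opt by (simp add: optimal_solution_def)
  note X[measurable] = admissibleD(1)[OF adm]
  obtain A s0 where A[measurable]: "A \<in> sets M" and posA: "0 < measure M A" "0 < s0"
    and gainA: "\<And>w s. w \<in> A \<Longrightarrow> 0 < s \<Longrightarrow> s \<le> s0 \<Longrightarrow>
       U (X w) (B w) + ereal (1 * q * s) < U (X w + 1 * (s / \<xi> w)) (B w)"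
    using exploitable_set[OF X admissibleD(2)[OF adm], of 1 q] neg by blast
  obtain C r0 where C[measurable]: "C \<in> sets M" and posC: "0 < measure M C" "0 < r0"
    and gainC: "\<And>w s. w \<in> C \<Longrightarrow> 0 < s \<Longrightarrow> s \<le> r0 \<Longrightarrow>
       U (X w) (B w) + ereal (- 1 * p * s) < U (X w + - 1 * (s / \<xi> w)) (B w)"
    using exploitable_set[OF X admissibleD(2)[OF adm], of "-1" p] neg by blast
  \<comment> \<open>The sets are almost disjoint: buying and selling in the same state cannot both be
    profitable, by midpoint concavity at \<open>X\<close>.\<close>
  have disj: False if w: "w \<in> space M" "- \<infinity> < U (X w) (B w)" "w \<in> A" "w \<in> C" for w
  proof -
    define s where "s = min s0 r0"
    have s: "0 < s" "s \<le> s0" "s \<le> r0" using posA posC by (auto simp: s_def)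
    note b = B_space[OF w(1)]
    obtain u where u: "U (X w) (B w) = ereal u"
      using w U_not_infty[OF b] by (cases "U (X w) (B w)") auto
    let ?k = "s / \<xi> w"
    obtain v where v: "U (X w + ?k) (B w) = ereal v"
      using gainA[OF w(3) s(1,2)] U_not_infty[OF b] u by (cases "U (X w + ?k) (B w)") auto
    obtain v' where v': "U (X w - ?k) (B w) = ereal v'"
      using gainC[OF w(4) s(1,3)] U_not_infty[OF b] u by (cases "U (X w - ?k) (B w)") auto
    have "ereal (1 - 1/2) * U (X w - ?k) (B w) + ereal (1/2) * U (X w + ?k) (B w)
        \<le> U ((1 - 1/2) * (X w - ?k) + (1/2) * (X w + ?k)) (B w)"
      using U_concave[OF b, unfolded ext_concave_def, rule_format, of "1/2"] by simp
    also have "(1 - 1/2) * (X w - ?k) + (1/2) * (X w + ?k) = X w" by (simp add: field_simps)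
    finally have "v' / 2 + v / 2 \<le> u" by (simp add: u v v')
    moreover have "u + q * s < v" using gainA[OF w(3) s(1,2)] u v by simp
    moreover have "u - p * s < v'" using gainC[OF w(4) s(1,3)] u v' by simp
    moreover have "p * s < q * s" using pq s by simp
    ultimately show False by simp
  qed
  define c where "c = min s0 r0"
  \<comment> \<open>Crossing the probabilities makes the expected money spent equal to that raised.\<close>
  define s where "s = c * measure M C"
  define r where "r = c * measure M A"
  have c: "0 < c" using posA posC by (simp add: c_def)
  have "s \<le> c * 1" "r \<le> c * 1" unfolding s_def r_def using c by (auto intro!: mult_left_mono)
  then have s: "0 < s" "s \<le> s0" and r: "0 < r" "r \<le> r0"
    using posA posC c by (auto simp: s_def r_def c_def)
  let ?D = "\<lambda>w. (s * indicator A w - r * indicator C w) / \<xi> w"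
  let ?g = "\<lambda>w. q * s * indicator A w - p * r * indicator C w"
  have D: "\<xi> w * ?D w = s * indicator A w - r * indicator C w" if "w \<in> space M" for w
    using \<xi>_pos[OF that] by simp
  have int_A: "integrable M (\<lambda>w. a * indicator A w :: real)" and
    int_C: "integrable M (\<lambda>w. a * indicator C w :: real)" for a :: real
    by (intro integrable_mult_right integrable_real_indicator; auto simp: less_top[symmetric])+
  have int_D: "integrable M (\<lambda>w. \<xi> w * ?D w)"
    using Bochner_Integration.integrable_diff[OF int_A int_C]
    by (subst Bochner_Integration.integrable_cong[OF refl D]) auto
  have "(\<integral>w. \<xi> w * ?D w \<partial>M) = (\<integral>w. s * indicator A w - r * indicator C w \<partial>M)"
    by (rule Bochner_Integration.integral_cong[OF refl D])
  also have "\<dots> = s * measure M A - r * measure M C"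
    by (subst Bochner_Integration.integral_diff[OF int_A int_C]) auto
  also have "\<dots> = 0" by (simp add: s_def r_def)
  finally have budget: "cost M \<xi> X + ereal (\<integral>w. \<xi> w * ?D w \<partial>M) \<le> ereal x0"
    using admissibleD(3)[OF adm] by simp
  have "(\<integral>w. ?g w \<partial>M) \<le> 0"
  proof (rule optimal_no_improvement[OF feas opt _ int_D _ _ budget])
    show "AE w in M. U (X w) (B w) + ereal (?g w) \<le> U (X w + ?D w) (B w)"
      using admissibleD(2)[OF adm] AE_space
    proof eventually_elim
      case (elim w)
      then show ?case
        using disj[of w] gainA[OF _ s, of w] gainC[OF _ r, of w]
        by (cases "w \<in> A"; cases "w \<in> C") auto
    qed
  qed (auto intro!: Bochner_Integration.integrable_diff int_A int_C)
  moreover have "(\<integral>w. ?g w \<partial>M) = q * s * measure M A - p * r * measure M C"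
    by (subst Bochner_Integration.integral_diff[OF int_A int_C]) auto
  moreover have "q * s * measure M A - p * r * measure M C = (q - p) * (c * measure M A * measure M C)"
    by (simp add: s_def r_def algebra_simps)
  moreover have "0 < (q - p) * (c * measure M A * measure M C)"
    using pq c posA posC by simp
  ultimately show False by simp
qed

lemma in_conjugate_set_if_rate_bounds:
  assumes fin: "AE w in M. - \<infinity> < U (X w) (B w)"
    and "rate_bound 1 X l" "rate_bound (-1) X l"
  shows "in_conjugate_set M \<xi> B U (ereal l) X"
  using assms(2,3) fin AE_space unfolding in_conjugate_set_def rate_bound_def
proof eventually_elim
  case (elim w)
  note b = B_space[OF elim(4)]
  obtain u where u: "U (X w) (B w) = ereal u"
    using elim U_not_infty[OF b] by (cases "U (X w) (B w)") auto
  have "ereal (X w) \<in> conjugate_set U (B w) (ereal (l * \<xi> w))"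
    using elim u U_not_infty[OF b] by (intro in_conjugate_set_if_rates[where u = u]) (auto simp: mult.assoc)
  then show ?case by simp
qed

text \<open>
  If every unit sold costs arbitrarily much utility, the utility is minus infinity below \<open>X\<close>.
\<close>

lemma in_conjugate_set_infty_if_rate_bounds:
  assumes fin: "AE w in M. - \<infinity> < U (X w) (B w)"
    and down: "\<And>n::nat. rate_bound (-1) X (real n)"
  shows "in_conjugate_set M \<xi> B U \<infinity> X"
proof -
  have "AE w in M. \<forall>n::nat. \<forall>h>0. U (X w + - 1 * h) (B w) \<le> U (X w) (B w) + ereal (- 1 * real n * \<xi> w * h)"
    using down unfolding rate_bound_def AE_all_countable by blast
  then show ?thesis
    unfolding in_conjugate_set_def using fin AE_space
  proof eventually_elim
    case (elim w)
    note b = B_space[OF elim(3)] and \<xi> = \<xi>_pos[OF elim(3)]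
    obtain u where u: "U (X w) (B w) = ereal u"
      using elim U_not_infty[OF b] by (cases "U (X w) (B w)") auto
    have below: "U z (B w) = - \<infinity>" if "z < X w" for z
    proof (rule ccontr)
      assume "U z (B w) \<noteq> - \<infinity>"
      then obtain v where v: "U z (B w) = ereal v" using U_not_infty[OF b, of z] by (cases "U z (B w)") auto
      have k: "0 < \<xi> w * (X w - z)" using \<xi> that by simp
      obtain n where n: "u - v < real n * (\<xi> w * (X w - z))"
        using reals_Archimedean3[OF k] by blast
      show False using elim(1)[rule_format, of "X w - z" n] that u v n by (simp add: algebra_simps)
    qed
    have "lower_endpoint U (B w) = ereal (X w)"
      unfolding lower_endpoint_def
    proof (rule antisym)
      show "(INF x\<in>{x. U x (B w) > - \<infinity>}. ereal x) \<le> ereal (X w)"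
        using elim(2) by (intro INF_lower) auto
      show "ereal (X w) \<le> (INF x\<in>{x. U x (B w) > - \<infinity>}. ereal x)"
        using below by (intro INF_greatest) (force simp: not_less[symmetric])
    qed
    then show ?case using \<xi> by (simp add: conjugate_set_def)
  qed
qed

lemma rate_bound_up_mono:
  assumes "rate_bound 1 X l" "l \<le> l'"
  shows "rate_bound 1 X l'"
  using assms(1) AE_space unfolding rate_bound_def
proof eventually_elim
  case (elim w)
  show ?case
  proof (intro allI impI)
    fix h :: real assume "h > 0"
    have "U (X w + 1 * h) (B w) \<le> U (X w) (B w) + ereal (1 * l * \<xi> w * h)" using elim \<open>h > 0\<close> by blast
    also have "\<dots> \<le> U (X w) (B w) + ereal (1 * l' * \<xi> w * h)"
      using \<open>l \<le> l'\<close> \<open>h > 0\<close> \<xi>_pos[OF elim(2)] by (intro add_left_mono) (auto intro!: mult_right_mono)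
    finally show "U (X w + 1 * h) (B w) \<le> U (X w) (B w) + ereal (1 * l' * \<xi> w * h)" .
  qed
qed

text \<open>
  The multiplier is the infimum of the nonnegative upper rates, and infinity if there are none. Below
  a positive infimum there are no nonnegative upper rates, so everything there is a lower rate, and
  closedness passes both properties to the infimum. At a zero infimum the lower rate comes from
  monotonicity of the utility.
\<close>

lemma optimal_multiplier:
  assumes feas: "feasible_problem M \<xi> B U x0" and opt: "optimal_solution M \<xi> B U x0 X"
  shows "\<exists>l\<ge>0. in_conjugate_set M \<xi> B U l X"
proof -
  have fin: "AE w in M. - \<infinity> < U (X w) (B w)"
    using opt by (simp add: optimal_solution_def admissible_def)
  define L where "L = {l. 0 \<le> l \<and> rate_bound 1 X l}"
  show ?thesis
  proof (cases "L = {}")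
    case True
    have "rate_bound (-1) X (real n)" for n
      using optimal_rates_ordered[OF feas opt, of "real n" "real n + 1"] True by (auto simp: L_def)
    then show ?thesis using in_conjugate_set_infty_if_rate_bounds[OF fin]
      by (intro exI[of _ \<infinity>]) simp
  next
    case False
    have bdd: "bdd_below L" by (auto simp: L_def bdd_below_def)
    define l where "l = Inf L"
    have l0: "0 \<le> l" unfolding l_def using False by (intro cInf_greatest) (auto simp: L_def)
    have e: "0 < 1 / real (Suc n)" for n by simp
    have lim: "(\<lambda>n. 1 / real (Suc n)) \<longlonglongrightarrow> 0" by (rule LIMSEQ_Suc[OF lim_1_over_n])
    have up: "rate_bound 1 X (l + 1 / real (Suc n))" for n
    proof -
      obtain l' where "l' \<in> L" "l' < l + 1 / real (Suc n)"
        using cInf_lessD[OF False, of "l + 1 / real (Suc n)"] e[of n] unfolding l_def by auto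
      then show ?thesis using rate_bound_up_mono[of X l'] by (simp add: L_def)
    qed
    have up_l: "rate_bound 1 X l"
      using rate_bound_LIMSEQ[OF fin up] tendsto_add[OF tendsto_const[of l] lim] by simp
    have down_l: "rate_bound (-1) X l"
    proof (cases "l = 0")
      case True
      then show ?thesis using rate_bound_down_0 by simp
    next
      case False
      have "rate_bound (-1) X (l - l / real (Suc n))" for n
      proof -
        define e where "e = l / real (Suc n)"
        have e: "0 < e" "e \<le> l" using l0 False by (auto simp: e_def field_simps)
        have "\<not> rate_bound 1 X (l - e / 2)"
        proof
          assume "rate_bound 1 X (l - e / 2)"
          then have "l - e / 2 \<in> L" using e by (simp add: L_def)
          then have "l \<le> l - e / 2" unfolding l_def by (intro cInf_lower bdd)
          with e show False by simp
        qed
        then show ?thesis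
          using optimal_rates_ordered[OF feas opt, of "l - e" "l - e / 2"] e
          unfolding e_def[symmetric] by simp
      qed
      moreover have "(\<lambda>n. l - l / real (Suc n)) \<longlonglongrightarrow> l"
        using tendsto_diff[OF tendsto_const[of l] tendsto_mult[OF tendsto_const[of l] lim]] by simp
      ultimately show ?thesis by (rule rate_bound_LIMSEQ[OF fin])
    qed
    show ?thesis using in_conjugate_set_if_rate_bounds[OF fin up_l down_l] l0
      by (intro exI[of _ "ereal l"]) simp
  qed
qed

lemma optimal_slack_multiplier:
  assumes feas: "feasible_problem M \<xi> B U x0" and opt: "optimal_solution M \<xi> B U x0 X"
    and slack: "cost M \<xi> X < ereal x0"
  shows "in_conjugate_set M \<xi> B U 0 X"
proof -
  have fin: "AE w in M. - \<infinity> < U (X w) (B w)"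
    using opt by (simp add: optimal_solution_def admissible_def)
  have "rate_bound 1 X (1 / real (Suc n))" for n
    by (rule optimal_slack_budget[OF feas opt slack]) simp
  then have "rate_bound 1 X 0"
    by (rule rate_bound_LIMSEQ[OF fin]) (rule LIMSEQ_Suc[OF lim_1_over_n])
  from in_conjugate_set_if_rate_bounds[OF fin this rate_bound_down_0]
  show ?thesis by (simp add: zero_ereal_def)
qed

section \<open>Sufficiency of the first-order condition\<close>

text \<open>
  Only a competitor \<open>Y\<close> with finite expected utility matters. The tangent inequality then bounds
  \<open>U(X,B)\<close> from below by an integrable function, since \<open>\<xi> Y\<close> has an integrable positive part; so
  \<open>U(X,B)\<close> is integrable. Read in the other direction, for \<open>l > 0\<close>, the same inequality bounds \<open>\<xi> Y\<close>
  from below, so that the cost of \<open>Y\<close> can be compared with \<open>x0\<close>.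
\<close>

lemma conjugate_set_real_optimal:
  assumes feas: "feasible_problem M \<xi> B U x0"
    and adm: "admissible M \<xi> B U x0 X" and cost: "cost M \<xi> X = ereal x0"
    and l: "0 \<le> l" and conj: "in_conjugate_set M \<xi> B U (ereal l) X"
    and admY: "admissible M \<xi> B U x0 Y"
  shows "expected_utility M B U Y \<le> expected_utility M B U X"
proof (cases "expected_utility M B U Y = - \<infinity>")
  case False
  note X[measurable] = admissibleD(1)[OF adm] and Y[measurable] = admissibleD(1)[OF admY]
  let ?u = "\<lambda>w. real_of_ereal (U (X w) (B w))" and ?v = "\<lambda>w. real_of_ereal (U (Y w) (B w))"
  note Xi = cost_eqD[OF X cost]
  have tangent: "AE w in M. U (Y w) (B w) + ereal (l * \<xi> w * X w - l * \<xi> w * Y w) \<le> U (X w) (B w)"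
    using conj admissibleD(2)[OF adm] AE_space unfolding in_conjugate_set_def
  proof eventually_elim
    case (elim w)
    note b = B_space[OF elim(3)]
    obtain u where u: "U (X w) (B w) = ereal u"
      using elim U_not_infty[OF b] by (cases "U (X w) (B w)") auto
    have "U (Y w) (B w) - ereal (l * \<xi> w * Y w) \<le> U (X w) (B w) - ereal (l * \<xi> w * X w)"
      using elim(1) by (simp add: real_in_conjugate_set_iff)
    then show ?case using U_not_infty[OF b, of "Y w"] u by (cases "U (Y w) (B w)") auto
  qed
  have v: "integrable M ?v" "AE w in M. U (Y w) (B w) = ereal (?v w)"
      "expected_utility M B U Y = ereal (\<integral>w. ?v w \<partial>M)"
    using ext_expectation_finiteD[OF measurable_utility[OF Y]] False
      admissible_utility_not_infty[OF feas admY]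
    unfolding expected_utility_def by blast+
  \<comment> \<open>The negative part of \<open>\<xi> Y\<close> may not be integrable, so it is dropped from the lower bound.\<close>
  have int_pos: "integrable M (\<lambda>w. max (\<xi> w * Y w) 0)"
    by (intro integrable_max_0 admissibleD(4)[OF admY]) measurable
  let ?g = "\<lambda>w. ?v w + (l * (\<xi> w * X w) - l * max (\<xi> w * Y w) 0)"
  have int_g: "integrable M ?g" using v(1) int_pos Xi(1) by auto
  have "AE w in M. ereal (?g w) \<le> U (X w) (B w)"
    using tangent v(2)
  proof eventually_elim
    case (elim w)
    have "l * (\<xi> w * Y w) \<le> l * max (\<xi> w * Y w) 0" using l by (intro mult_left_mono) auto
    then have "ereal (?g w) \<le> ereal (?v w + (l * \<xi> w * X w - l * \<xi> w * Y w))" by (simp add: mult.assoc)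
    also have "\<dots> \<le> U (X w) (B w)" using elim by (metis plus_ereal.simps(1))
    finally show ?case .
  qed
  from ext_expectation_mono[OF this] have "ereal (\<integral>w. ?g w \<partial>M) \<le> expected_utility M B U X"
    unfolding expected_utility_def ext_expectation_integrable[OF int_g] .
  then have "expected_utility M B U X \<noteq> - \<infinity>" by auto
  then have u: "integrable M ?u" "AE w in M. U (X w) (B w) = ereal (?u w)"
      "expected_utility M B U X = ereal (\<integral>w. ?u w \<partial>M)"
    using ext_expectation_finiteD[OF measurable_utility[OF X]]
      admissible_utility_not_infty[OF feas adm]
    unfolding expected_utility_def by blast+
  have tangent': "AE w in M. ?v w - ?u w \<le> l * (\<xi> w * Y w - \<xi> w * X w)"
    using tangent u(2) v(2)
  proof eventually_elim
    case (elim w)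
    have "ereal (?v w + (l * \<xi> w * X w - l * \<xi> w * Y w)) \<le> ereal (?u w)"
      using elim by (metis plus_ereal.simps(1))
    then show ?case by (simp add: algebra_simps)
  qed
  have "(\<integral>w. ?v w \<partial>M) \<le> (\<integral>w. ?u w \<partial>M)"
  proof (cases "l = 0")
    case True
    show ?thesis using tangent' True by (intro integral_mono_AE v(1) u(1)) auto
  next
    case False
    let ?k = "\<lambda>w. \<xi> w * X w + (?v w - ?u w) / l"
    have int_k: "integrable M ?k" using Xi(1) u(1) v(1) by auto
    have "AE w in M. ereal (?k w) \<le> ereal (\<xi> w * Y w)"
      using tangent' by eventually_elim (use l False in \<open>simp add: field_simps\<close>)
    from ext_expectation_mono[OF this] have "ereal (\<integral>w. ?k w \<partial>M) \<le> cost M \<xi> Y"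
      unfolding cost_def ext_expectation_integrable[OF int_k] .
    also have "\<dots> \<le> ereal x0" by (rule admissibleD(3)[OF admY])
    finally have "(\<integral>w. ?k w \<partial>M) \<le> x0" by simp
    moreover have "(\<integral>w. ?k w \<partial>M) = x0 + ((\<integral>w. ?v w \<partial>M) - (\<integral>w. ?u w \<partial>M)) / l"
      using Xi u(1) v(1) by simp
    ultimately have "((\<integral>w. ?v w \<partial>M) - (\<integral>w. ?u w \<partial>M)) / l \<le> 0" by simp
    then show ?thesis using l False by (simp add: divide_le_0_iff)
  qed
  then show ?thesis using u(3) v(3) by simp
qed simp

text \<open>
  Every admissible \<open>Y\<close> dominates the lower endpoint \<open>X\<close> and may not cost more, so it equals \<open>X\<close> almost
  surely.
\<close>

lemma lower_endpoint_optimal: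
  assumes adm: "admissible M \<xi> B U x0 X" and cost: "cost M \<xi> X = ereal x0"
    and conj: "in_conjugate_set M \<xi> B U \<infinity> X"
    and admY: "admissible M \<xi> B U x0 Y"
  shows "expected_utility M B U Y = expected_utility M B U X"
proof -
  note X[measurable] = admissibleD(1)[OF adm] and Y[measurable] = admissibleD(1)[OF admY]
  note Xi = cost_eqD[OF X cost]
  have le: "AE w in M. \<xi> w * X w \<le> \<xi> w * Y w"
    using conj admissibleD(2)[OF admY] AE_space unfolding in_conjugate_set_def
  proof eventually_elim
    case (elim w)
    note \<xi> = \<xi>_pos[OF elim(3)]
    have "ereal (X w) = lower_endpoint U (B w)" using elim(1) \<xi> by (simp add: conjugate_set_def)
    also have "\<dots> \<le> ereal (Y w)"
      unfolding lower_endpoint_def using elim(2) by (intro INF_lower) auto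
    finally show ?case using \<xi> by simp
  qed
  then have "cost M \<xi> X \<le> cost M \<xi> Y" unfolding cost_def by (intro ext_expectation_mono) auto
  then have "cost M \<xi> Y = ereal x0" using cost admissibleD(3)[OF admY] by simp
  note Yi = cost_eqD[OF Y this]
  have "(\<integral>w. \<xi> w * Y w - \<xi> w * X w \<partial>M) = 0" using Xi Yi by simp
  then have "AE w in M. \<xi> w * Y w - \<xi> w * X w = 0"
    using le Xi(1) Yi(1) by (subst (asm) integral_nonneg_eq_0_iff_AE) auto
  then have "AE w in M. U (Y w) (B w) = U (X w) (B w)"
    using AE_space
  proof eventually_elim
    case (elim w)
    then show ?case using \<xi>_pos[OF elim(2)] by simp
  qed
  then show ?thesis unfolding expected_utility_def by (rule ext_expectation_cong)
qed

lemma conjugate_set_optimal: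
  assumes feas: "feasible_problem M \<xi> B U x0"
    and adm: "admissible M \<xi> B U x0 X" and cost: "cost M \<xi> X = ereal x0"
    and l: "0 \<le> l" and conj: "in_conjugate_set M \<xi> B U l X"
  shows "optimal_solution M \<xi> B U x0 X"
proof (rule optimal_solutionI[OF adm])
  fix Y assume Y: "admissible M \<xi> B U x0 Y"
  show "expected_utility M B U Y \<le> expected_utility M B U X"
  proof (cases l)
    case (real r)
    then show ?thesis using conjugate_set_real_optimal[OF feas adm cost _ _ Y] l conj by auto
  next
    case PInf
    then show ?thesis using lower_endpoint_optimal[OF adm cost _ Y] conj by auto
  qed (use l in auto)
qed

lemma infeasible_optimal:
  assumes "\<not> feasible_problem M \<xi> B U x0" and "admissible M \<xi> B U x0 X"
  shows "optimal_solution M \<xi> B U x0 X"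
  using assms by (intro optimal_solutionI) (auto simp: feasible_problem_def)

end

section \<open>The characterization\<close>

theorem theorem1:
  fixes M :: "'a measure" and E :: "'e measure"
    and \<xi> :: "'a \<Rightarrow> real" and B :: "'a \<Rightarrow> 'e"
    and U :: "real \<Rightarrow> 'e \<Rightarrow> ereal"
    and x0 :: real and X :: "'a \<Rightarrow> real"
  assumes "prob_space M"
    and "\<xi> \<in> borel_measurable M" and "\<And>\<omega>. \<omega> \<in> space M \<Longrightarrow> 0 < \<xi> \<omega>"
    and "B \<in> measurable M E"
    and "\<And>x. U x \<in> borel_measurable E"
    and "\<And>x b. b \<in> space E \<Longrightarrow> U x b \<noteq> \<infinity>"
    and "well_defined_problem M \<xi> B U x0" and "finite_problem M \<xi> B U x0"
    and "\<And>b. b \<in> space E \<Longrightarrow> mono (\<lambda>x. U x b)"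
    and "\<And>b. b \<in> space E \<Longrightarrow> upper_semicontinuous (\<lambda>x. U x b)"
    and "\<And>b. b \<in> space E \<Longrightarrow> ext_concave (\<lambda>x. U x b)"
    and "X \<in> borel_measurable M"
  shows
    "(feasible_problem M \<xi> B U x0 \<longrightarrow>
        (optimal_solution M \<xi> B U x0 X \<and> cost M \<xi> X = ereal x0 \<longleftrightarrow>
         (\<exists>l\<ge>0. in_conjugate_set M \<xi> B U l X) \<and>
         cost M \<xi> X = ereal x0 \<and> (AE \<omega> in M. U (X \<omega>) (B \<omega>) > - \<infinity>))) \<and>
     (feasible_problem M \<xi> B U x0 \<longrightarrow>
        optimal_solution M \<xi> B U x0 X \<and> cost M \<xi> X \<noteq> ereal x0 \<longrightarrow>
         in_conjugate_set M \<xi> B U 0 X \<and> (AE \<omega> in M. U (X \<omega>) (B \<omega>) > - \<infinity>)) \<and>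
     (\<not> feasible_problem M \<xi> B U x0 \<longrightarrow>
        (\<exists>l\<ge>0. in_conjugate_set M \<xi> B U l X) \<and>
        cost M \<xi> X = ereal x0 \<and> (AE \<omega> in M. U (X \<omega>) (B \<omega>) > - \<infinity>) \<longrightarrow>
         optimal_solution M \<xi> B U x0 X)"
proof -
  interpret prob_space M by fact
  interpret utility_problem M E \<xi> B U x0
    by unfold_locales (use assms in auto)
  show ?thesis
  proof (intro conjI impI)
    assume feas: "feasible_problem M \<xi> B U x0"
    show "optimal_solution M \<xi> B U x0 X \<and> cost M \<xi> X = ereal x0 \<longleftrightarrow>
         (\<exists>l\<ge>0. in_conjugate_set M \<xi> B U l X) \<and>
         cost M \<xi> X = ereal x0 \<and> (AE \<omega> in M. U (X \<omega>) (B \<omega>) > - \<infinity>)"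
      using optimal_multiplier[OF feas, of X] conjugate_set_optimal[OF feas, of X]
        admissible_of_cost_eq[of X] assms(12)
      by (auto simp: optimal_solution_def dest: admissibleD(2))
  next
    assume feas: "feasible_problem M \<xi> B U x0"
      and opt: "optimal_solution M \<xi> B U x0 X \<and> cost M \<xi> X \<noteq> ereal x0"
    then have adm: "admissible M \<xi> B U x0 X" by (simp add: optimal_solution_def)
    then show "AE \<omega> in M. U (X \<omega>) (B \<omega>) > - \<infinity>" by (rule admissibleD)
    show "in_conjugate_set M \<xi> B U 0 X"
      using optimal_slack_multiplier[OF feas, of X] opt admissibleD(3)[OF adm] by (simp add: order_less_le)
  next
    assume "\<not> feasible_problem M \<xi> B U x0"
      and "(\<exists>l\<ge>0. in_conjugate_set M \<xi> B U l X) \<and>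
        cost M \<xi> X = ereal x0 \<and> (AE \<omega> in M. U (X \<omega>) (B \<omega>) > - \<infinity>)"
    then show "optimal_solution M \<xi> B U x0 X"
      using admissible_of_cost_eq assms(12) by (intro infeasible_optimal) auto
  qed
qed

end
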